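(* Let $(U^k)_{k\ge0}\subset Z_h^0$ be a solution of the CNFD scheme described in the context. Then it satisfies the following conservation laws for all $k\ge0$: $$E^k:=\|\delta_x^+U^k\|^2+\lambda|U_M^k|^2+\mu h\sum_{j=0}^{2M-1}Q(|U_j^k|^2)=E^0,$$ $$M^k:=\|U^k\|^2=M^0 .$$
   Context: Let $a>0$, $\lambda,\mu\in\mathbb{R}$, $\varepsilon>0$ a (small) regularization parameter, $u_0$ a complex-valued function on $[-a,a]$ vanishing at $\pm a$. **Grid and notation.** For a positive integer $M$ let $h=a/M$, $x_j=-a+jh$ ($0\le j\le 2M$, so $x_M=0$); let $\tau>0$ be the time step. $Z_h^0$ is the space of complex mesh functions $(u_j)_{0\le j\le 2M}$ with $u_0=u_{2M}=0$. Set $\delta_t^+U_j^k=\frac{1}{\tau}(U_j^{k+1}-U_j^k)$, $U_j^{k+1/2}=\frac12(U_j^{k+1}+U_j^k)$, $\delta_x^+U_j=\frac1h(U_{j+1}-U_j)$ (for $0\le j\le 2M-1$), $\delta_x^2U_j=\frac1{h^2}(U_{j+1}-2U_j+U_{j-1})$. Norm: $\|U\|^2=h\sum_{j=0}^{2M-1}|U_j|^2$ (and likewise for $\delta_x^+U$). **Nonlinearity.** $q(s)=\ln\big((\varepsilon+\sqrt s)^2\big)=2\ln(\varepsilon+\sqrt s)$ and $Q(s)=\int_0^sq(s_1)\,ds_1$ for $s\ge0$; for $z_1,z_2\in\mathbb{C}$, $$\tilde Q(z_1,z_2)=\frac12\int_0^1q\big(\theta|z_1|^2+(1-\theta)|z_2|^2\big)\,d\theta\,(z_1+z_2),$$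 which equals $\frac12\frac{Q(|z_1|^2)-Q(|z_2|^2)}{|z_1|^2-|z_2|^2}(z_1+z_2)$ when $|z_1|\neq|z_2|$. **CNFD scheme.** $U_j^0=u_0(x_j)$ for $0\le j\le 2M$, and for $k\ge0$, $U^{k+1}\in Z_h^0$ satisfies $$i\delta_t^+U_j^k=-\delta_x^2U_j^{k+1/2}+\lambda b_jU_j^{k+1/2}+\mu\tilde Q(U_j^{k+1},U_j^k),\quad 1\le j\le 2M-1,$$ with $b_M=\frac1h$ and $b_j=0$ for $j\ne M$. (The integer $M$ and the discrete mass $M^k$ are different objects; $M^k$ denotes the mass at step $k$.) *)

theory Defs
  imports "HOL-Analysis.Analysis"
begin

text \<open>A mesh function \<open>(u\<^sub>j)\<close>, \<open>0 \<le> j \<le> 2M\<close>, is represented by a function on \<open>nat\<close>; its values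
  at indices above \<open>2M\<close> are arbitrary, and nothing below refers to them.\<close>

type_synonym mesh_fun = "nat \<Rightarrow> complex"

definition grid_point :: "real \<Rightarrow> real \<Rightarrow> nat \<Rightarrow> real" where
  "grid_point a h j = - a + real j * h"

definition Zh0 :: "nat \<Rightarrow> mesh_fun set" where
  "Zh0 M = {u. u 0 = 0 \<and> u (2 * M) = 0}"

definition dt_plus :: "real \<Rightarrow> (nat \<Rightarrow> mesh_fun) \<Rightarrow> nat \<Rightarrow> mesh_fun" where
  "dt_plus \<tau> U k j = (U (k + 1) j - U k j) / complex_of_real \<tau>"

definition half_step :: "(nat \<Rightarrow> mesh_fun) \<Rightarrow> nat \<Rightarrow> mesh_fun" where
  "half_step U k j = (U (k + 1) j + U k j) / 2"

definition dx_plus :: "real \<Rightarrow> mesh_fun \<Rightarrow> mesh_fun" where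
  "dx_plus h u j = (u (j + 1) - u j) / complex_of_real h"

text \<open>Only meaningful for \<open>j \<ge> 1\<close>, because of the truncated \<open>j - 1\<close>.\<close>

definition dx2 :: "real \<Rightarrow> mesh_fun \<Rightarrow> mesh_fun" where
  "dx2 h u j = (u (j + 1) - 2 * u j + u (j - 1)) / complex_of_real (h\<^sup>2)"

definition mesh_norm :: "real \<Rightarrow> nat \<Rightarrow> mesh_fun \<Rightarrow> real" where
  "mesh_norm h M u = sqrt (h * (\<Sum>j<2 * M. (cmod (u j))\<^sup>2))"

definition q_reg :: "real \<Rightarrow> real \<Rightarrow> real" where
  "q_reg \<epsilon> s = ln ((\<epsilon> + sqrt s)\<^sup>2)"

definition Q_reg :: "real \<Rightarrow> real \<Rightarrow> real" where
  "Q_reg \<epsilon> s = integral {0..s} (q_reg \<epsilon>)"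

definition Q_tilde :: "real \<Rightarrow> complex \<Rightarrow> complex \<Rightarrow> complex" where
  "Q_tilde \<epsilon> z1 z2 =
     complex_of_real
       (1 / 2 * integral {0..1} (\<lambda>\<theta>. q_reg \<epsilon> (\<theta> * (cmod z1)\<^sup>2 + (1 - \<theta>) * (cmod z2)\<^sup>2)))
     * (z1 + z2)"

text \<open>The discrete Dirac delta at the origin \<open>x\<^sub>M = 0\<close>.\<close>

definition delta_coeff :: "real \<Rightarrow> nat \<Rightarrow> nat \<Rightarrow> real" where
  "delta_coeff h M j = (if j = M then 1 / h else 0)"

definition CNFD_solution ::
  "real \<Rightarrow> nat \<Rightarrow> real \<Rightarrow> real \<Rightarrow> real \<Rightarrow> real \<Rightarrow> real \<Rightarrow> (real \<Rightarrow> complex) \<Rightarrow> (nat \<Rightarrow> mesh_fun) \<Rightarrow> bool"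
where
  "CNFD_solution a M h \<tau> \<epsilon> lam \<mu> u0 U \<longleftrightarrow>
     (\<forall>k. U k \<in> Zh0 M) \<and>
     (\<forall>j\<in>{0..2 * M}. U 0 j = u0 (grid_point a h j)) \<and>
     (\<forall>k. \<forall>j\<in>{1..2 * M - 1}.
        \<i> * dt_plus \<tau> U k j =
          - dx2 h (half_step U k) j
          + complex_of_real (lam * delta_coeff h M j) * half_step U k j
          + complex_of_real \<mu> * Q_tilde \<epsilon> (U (k + 1) j) (U k j))"

definition discrete_energy ::
  "nat \<Rightarrow> real \<Rightarrow> real \<Rightarrow> real \<Rightarrow> real \<Rightarrow> mesh_fun \<Rightarrow> real"
where
  "discrete_energy M h \<epsilon> lam \<mu> u =
     (mesh_norm h M (dx_plus h u))\<^sup>2 + lam * (cmod (u M))\<^sup>2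
     + \<mu> * h * (\<Sum>j<2 * M. Q_reg \<epsilon> ((cmod (u j))\<^sup>2))"

definition discrete_mass :: "nat \<Rightarrow> real \<Rightarrow> mesh_fun \<Rightarrow> real" where
  "discrete_mass M h u = (mesh_norm h M u)\<^sup>2"

end

theory Submission
  imports Defs
begin

text \<open>Testing the scheme at step \<open>k\<close> with the conjugate of \<open>U\<^sup>k\<^sup>+\<^sup>1 - U\<^sup>k\<close> and taking real parts
  gives the energy law; testing it with the conjugate of the half step and taking imaginary parts
  gives the mass law. The averaged nonlinearity is designed so that its real part against
  \<open>U\<^sup>k\<^sup>+\<^sup>1 - U\<^sup>k\<close> is exactly half the increment of \<open>Q\<close>.\<close>

text \<open>Abel summation with both boundary terms kept. Using \<open>n + 1\<close> forward
  differences against \<open>n\<close> interior second differences lets the induction on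
  \<open>n\<close> add one term on each side. Since the right sum starts at 1, the truncated
  \<open>j - 1\<close> is harmless.\<close>

lemma sum_by_parts_second_difference:
  fixes p c :: "nat \<Rightarrow> 'a::comm_ring_1"
  shows "(\<Sum>j<Suc n. (p (j + 1) - p j) * (c (j + 1) - c j)) =
    (p (Suc n) - p n) * c (Suc n) - (p 1 - p 0) * c 0
    - (\<Sum>j=1..n. (p (j + 1) - 2 * p j + p (j - 1)) * c j)"
  by (induction n) (simp_all add: algebra_simps)

text \<open>A discrete Green identity: the boundary terms of the summation by parts carry the end
  values of \<open>r\<close> as factors, and these vanish. The mass law takes \<open>r = p\<close>,
  the energy law takes \<open>r\<close> to be the time increment.\<close>

lemma sum_dx2_mult_cnj:
  assumes "M > 0" and "r \<in> Zh0 M"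
  shows "(\<Sum>j\<in>{1..2 * M - 1}. dx2 h p j * cnj (r j))
    = - (\<Sum>j<2 * M. dx_plus h p j * cnj (dx_plus h r j))"
proof -
  \<comment> \<open>\<open>M > 0\<close> makes the truncated subtraction exact, so that
    \<open>2 * M - 1\<close> interior nodes match \<open>2 * M\<close> cells.\<close>
  have N: "Suc (2 * M - 1) = 2 * M" using \<open>M > 0\<close> by simp
  have "(\<Sum>j<2 * M. (p (j + 1) - p j) * (cnj (r (j + 1)) - cnj (r j)))
      = - (\<Sum>j=1..2 * M - 1. (p (j + 1) - 2 * p j + p (j - 1)) * cnj (r j))"
    using sum_by_parts_second_difference[of p "\<lambda>j. cnj (r j)" "2 * M - 1"] assms
    unfolding N by (simp add: Zh0_def)
  moreover have "(\<Sum>j<2 * M. dx_plus h p j * cnj (dx_plus h r j))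
      = (\<Sum>j<2 * M. (p (j + 1) - p j) * (cnj (r (j + 1)) - cnj (r j))) / of_real (h\<^sup>2)"
    by (simp add: dx_plus_def sum_divide_distrib power2_eq_square)
  moreover have "(\<Sum>j\<in>{1..2 * M - 1}. dx2 h p j * cnj (r j))
      = (\<Sum>j=1..2 * M - 1. (p (j + 1) - 2 * p j + p (j - 1)) * cnj (r j)) / of_real (h\<^sup>2)"
    by (simp add: dx2_def sum_divide_distrib)
  ultimately show ?thesis by simp
qed

text \<open>The regularization \<open>\<epsilon> > 0\<close> keeps the argument of the logarithm
  away from 0, even at \<open>s = 0\<close>.\<close>

lemma continuous_on_q_reg:
  assumes "\<epsilon> > 0"
  shows "continuous_on {0..} (q_reg \<epsilon>)"
  unfolding q_reg_def
proof (intro continuous_intros ballI)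
  fix s :: real assume "s \<in> {0..}"
  then have "\<epsilon> + sqrt s > 0" using assms by (simp add: add_pos_nonneg)
  then show "(\<epsilon> + sqrt s)\<^sup>2 \<noteq> 0" by simp
qed

text \<open>Substitute along the segment \<open>g\<close> from \<open>B\<close> to \<open>A\<close>
  and apply the fundamental theorem of calculus to \<open>Q_reg\<close> composed with
  \<open>g\<close>. The product form avoids dividing by \<open>A - B\<close>, so equal moduli need
  no separate case.\<close>

lemma Q_reg_diff:
  assumes "\<epsilon> > 0" "A \<ge> 0" "B \<ge> 0"
  shows "(A - B) * integral {0..1} (\<lambda>\<theta>. q_reg \<epsilon> (\<theta> * A + (1 - \<theta>) * B))
    = Q_reg \<epsilon> A - Q_reg \<epsilon> B"
proof -
  define g where "g = (\<lambda>\<theta>::real. \<theta> * A + (1 - \<theta>) * B)"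
  \<comment> \<open>The maximum makes \<open>{0..R}\<close> contain the whole segment, whichever
    endpoint is larger.\<close>
  define R where "R = max A B"
  have g: "g \<theta> \<in> {0..R}" if "\<theta> \<in> {0..1}" for \<theta>
  proof -
    have "g \<theta> \<le> \<theta> * R + (1 - \<theta>) * R"
      unfolding g_def R_def using that by (intro add_mono mult_left_mono) auto
    moreover have "g \<theta> \<ge> 0"
      unfolding g_def using that assms by (intro add_nonneg_nonneg mult_nonneg_nonneg) auto
    ultimately show ?thesis by (simp add: algebra_simps)
  qed
  have "((\<lambda>\<theta>. (A - B) *\<^sub>R q_reg \<epsilon> (g \<theta>)) has_integral Q_reg \<epsilon> (g 1) - Q_reg \<epsilon> (g 0)) {0..1}"
  proof (rule fundamental_theorem_of_calculus)
    fix \<theta> :: real assume \<theta>: "\<theta> \<in> {0..1}"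
    have "continuous_on {0..R} (q_reg \<epsilon>)"
      using continuous_on_q_reg[OF assms(1)] by (rule continuous_on_subset) auto
    from integral_has_vector_derivative[OF this g[OF \<theta>]]
    \<comment> \<open>The segment reaches the end \<open>R\<close>, and possibly 0, where the
      derivative is one-sided; hence it is taken within the image of \<open>g\<close>, as the chain
      rule requires.\<close>
    have "(Q_reg \<epsilon> has_vector_derivative q_reg \<epsilon> (g \<theta>)) (at (g \<theta>) within g ` {0..1})"
      unfolding Q_reg_def[abs_def]
      by (rule has_vector_derivative_within_subset) (use g in auto)
    moreover have "(g has_vector_derivative A - B) (at \<theta> within {0..1})"
      unfolding g_def by (auto intro!: derivative_eq_intros simp: algebra_simps)
    ultimately show "((\<lambda>\<theta>. Q_reg \<epsilon> (g \<theta>)) has_vector_derivative (A - B) *\<^sub>R q_reg \<epsilon> (g \<theta>))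
        (at \<theta> within {0..1})"
      using vector_diff_chain_within[of g "A - B" \<theta> "{0..1}" "Q_reg \<epsilon>"] by (simp add: o_def)
  qed simp
  then show ?thesis by (simp add: integral_unique g_def flip: integral_mult_right)
qed

lemma Re_complex_of_real_mult: "Re (complex_of_real r * z) = r * Re z"
  by simp

lemma Re_add_mult_cnj_diff: "Re ((v + u) * cnj (v - u)) = (cmod v)\<^sup>2 - (cmod u)\<^sup>2"
  unfolding cmod_power2 by (simp add: algebra_simps power2_eq_square)

text \<open>\<open>Q_tilde\<close> is a real factor times \<open>v + u\<close>, so the real part is
  that factor times the difference of the squared moduli, to which \<open>Q_reg_diff\<close>
  applies.\<close>

lemma Re_Q_tilde_mult_cnj_diff:
  assumes "\<epsilon> > 0"
  shows "Re (Q_tilde \<epsilon> v u * cnj (v - u)) = (Q_reg \<epsilon> ((cmod v)\<^sup>2) - Q_reg \<epsilon> ((cmod u)\<^sup>2)) / 2"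
  unfolding Q_tilde_def mult.assoc[of _ "v + u"] Re_complex_of_real_mult Re_add_mult_cnj_diff
  using Q_reg_diff[OF assms, of "(cmod v)\<^sup>2" "(cmod u)\<^sup>2"] by (simp add: mult_ac)

lemma mesh_norm_power2: "h \<ge> 0 \<Longrightarrow> (mesh_norm h M u)\<^sup>2 = h * (\<Sum>j<2 * M. (cmod (u j))\<^sup>2)"
  by (simp add: mesh_norm_def sum_nonneg)

lemma sum_lessThan_eq_interior:
  fixes f :: "nat \<Rightarrow> 'a::comm_monoid_add"
  assumes "f 0 = 0" "n > 0"
  shows "(\<Sum>j<n. f j) = (\<Sum>j\<in>{1..n - 1}. f j)"
proof -
  have "{..<n} = insert 0 {1..n - 1}" using assms by auto
  then show ?thesis using assms by simp
qed

lemma CNFD_step_mass: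
  assumes "h > 0" "\<tau> > 0" "M > 0" "CNFD_solution a M h \<tau> \<epsilon> lam \<mu> u0 U"
  shows "discrete_mass M h (U (Suc k)) = discrete_mass M h (U k)"
proof -
  define u v w where "u = U k" and "v = U (Suc k)" and "w = half_step U k"
  define I where "I = {1..2 * M - 1}"
  have bd: "u \<in> Zh0 M" "v \<in> Zh0 M" "w \<in> Zh0 M"
    using assms(4) by (auto simp: CNFD_solution_def u_def v_def w_def half_step_def Zh0_def)
  have w: "w j = (v j + u j) / 2" for j by (simp add: w_def half_step_def u_def v_def)
  have eq: "((cmod (v j))\<^sup>2 - (cmod (u j))\<^sup>2) / (2 * \<tau>) = - Im (dx2 h w j * cnj (w j))"
    if "j \<in> I" for j
  proof -
    \<comment> \<open>\<open>c\<close> is the averaging integral, because \<open>v j + u j\<close>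
      is twice \<open>w j\<close>. The delta and nonlinear terms are thus both real multiples of
      \<open>w j\<close> and become real after multiplication by its conjugate.\<close>
    obtain c where c: "Q_tilde \<epsilon> (v j) (u j) = of_real c * w j"
      using that unfolding Q_tilde_def w
      by (metis (no_types, lifting) mult.assoc mult.commute nonzero_mult_div_cancel_left of_real_mult
          of_real_numeral times_divide_eq_right zero_neq_numeral)
    have "\<i> * ((v j - u j) / of_real \<tau>)
        = - dx2 h w j + of_real (lam * delta_coeff h M j) * w j + of_real \<mu> * Q_tilde \<epsilon> (v j) (u j)"
      using assms(4) that by (simp add: CNFD_solution_def dt_plus_def u_def v_def w_def I_def)
    also have "\<dots> = - dx2 h w j + of_real (lam * delta_coeff h M j + \<mu> * c) * w j"
      by (simp add: c algebra_simps)
    finally have "\<i> * ((v j - u j) / of_real \<tau>) * cnj (w j)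
        = - (dx2 h w j * cnj (w j))
          + of_real ((lam * delta_coeff h M j + \<mu> * c) * (cmod (w j))\<^sup>2)"
      by (simp only: of_real_mult complex_norm_square) (simp add: algebra_simps)
    moreover have "Im (\<i> * ((v j - u j) / of_real \<tau>) * cnj (w j))
        = ((cmod (v j))\<^sup>2 - (cmod (u j))\<^sup>2) / (2 * \<tau>)"
      using assms(2) unfolding cmod_power2 by (simp add: w field_simps power2_eq_square)
    ultimately show ?thesis by simp
  qed
  have "(\<Sum>j\<in>I. ((cmod (v j))\<^sup>2 - (cmod (u j))\<^sup>2) / (2 * \<tau>)) = - Im (\<Sum>j\<in>I. dx2 h w j * cnj (w j))"
    by (simp add: eq sum_negf del: times_complex.sel)
  \<comment> \<open>With both arguments equal to \<open>w\<close>, the Green identity yields minus a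
    sum of squared moduli, which is real.\<close>
  also have "\<dots> = 0"
    unfolding I_def sum_dx2_mult_cnj[OF assms(3) bd(3)] by (simp add: mult.commute)
  finally have "(\<Sum>j\<in>I. (cmod (v j))\<^sup>2 - (cmod (u j))\<^sup>2) = 0"
    using assms(2) by (simp flip: sum_divide_distrib)
  then have "(\<Sum>j<2 * M. (cmod (v j))\<^sup>2 - (cmod (u j))\<^sup>2) = 0"
    using assms(3) bd by (subst sum_lessThan_eq_interior) (auto simp: Zh0_def I_def)
  then show ?thesis
    using assms(1) by (simp add: discrete_mass_def mesh_norm_power2 sum_subtractf u_def v_def)
qed

lemma CNFD_step_energy:
  assumes "h > 0" "\<epsilon> > 0" "M > 0" "CNFD_solution a M h \<tau> \<epsilon> lam \<mu> u0 U"
  shows "discrete_energy M h \<epsilon> lam \<mu> (U (Suc k)) = discrete_energy M h \<epsilon> lam \<mu> (U k)"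
proof -
  define u v w where "u = U k" and "v = U (Suc k)" and "w = half_step U k"
  \<comment> \<open>\<open>d\<close> is the discrete time derivative without its factor
    \<open>1 / \<tau>\<close>. Against its conjugate the left side of the scheme is purely
    imaginary, which explains the 0 in \<open>eq\<close> below.\<close>
  define d where "d = (\<lambda>j. v j - u j)"
  define I where "I = {1..2 * M - 1}"
  define D where "D = (\<lambda>j. (cmod (v j))\<^sup>2 - (cmod (u j))\<^sup>2)"
  define P where "P = (\<lambda>j. Q_reg \<epsilon> ((cmod (v j))\<^sup>2) - Q_reg \<epsilon> ((cmod (u j))\<^sup>2))"
  have bd: "u \<in> Zh0 M" "v \<in> Zh0 M" "d \<in> Zh0 M"
    using assms(4) by (auto simp: CNFD_solution_def u_def v_def d_def Zh0_def)
  have w: "w j = (v j + u j) / 2" for j by (simp add: w_def half_step_def u_def v_def)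
  have wd: "Re (w j * cnj (d j)) = D j / 2" for j
    using Re_add_mult_cnj_diff[of "v j" "u j"] by (simp add: w d_def D_def field_simps)
  have eq: "0 = - Re (dx2 h w j * cnj (d j)) + lam * delta_coeff h M j * (D j / 2) + \<mu> * (P j / 2)"
    if "j \<in> I" for j
  proof -
    have "\<i> * (d j / of_real \<tau>) * cnj (d j)
        = (- dx2 h w j + of_real (lam * delta_coeff h M j) * w j + of_real \<mu> * Q_tilde \<epsilon> (v j) (u j))
          * cnj (d j)"
      using assms(4) that by (simp add: CNFD_solution_def dt_plus_def u_def v_def w_def d_def I_def)
    also have "\<dots> = - (dx2 h w j * cnj (d j)) + of_real (lam * delta_coeff h M j) * (w j * cnj (d j))
        + of_real \<mu> * (Q_tilde \<epsilon> (v j) (u j) * cnj (d j))"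
      by (simp add: algebra_simps)
    finally have "Re (\<i> * (d j / of_real \<tau>) * cnj (d j))
        = - Re (dx2 h w j * cnj (d j)) + lam * delta_coeff h M j * (D j / 2) + \<mu> * (P j / 2)"
      using Re_Q_tilde_mult_cnj_diff[OF assms(2), of "v j" "u j"]
      by (simp only: plus_complex.sel uminus_complex.sel Re_complex_of_real_mult wd[unfolded d_def] d_def P_def)
    moreover have "Re (\<i> * (d j / of_real \<tau>) * cnj (d j)) = 0" by simp
    ultimately show ?thesis by simp
  qed
  \<comment> \<open>Forward differences in space commute with averaging and subtraction in time, so
    the identity behind \<open>wd\<close> applies again on each cell.\<close>
  have kin: "Re (\<Sum>j\<in>I. dx2 h w j * cnj (d j))
      = - (\<Sum>j<2 * M. (cmod (dx_plus h v j))\<^sup>2 - (cmod (dx_plus h u j))\<^sup>2) / 2"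
  proof -
    have "Re (dx_plus h w j * cnj (dx_plus h d j))
        = ((cmod (dx_plus h v j))\<^sup>2 - (cmod (dx_plus h u j))\<^sup>2) / 2" for j
    proof -
      have *: "dx_plus h w j = (dx_plus h v j + dx_plus h u j) / 2"
        "dx_plus h d j = dx_plus h v j - dx_plus h u j"
        by (simp_all add: dx_plus_def w d_def diff_divide_distrib add_divide_distrib mult.commute)
      show ?thesis
        unfolding * using Re_add_mult_cnj_diff[of "dx_plus h v j" "dx_plus h u j"]
        by (simp add: field_simps)
    qed
    then show ?thesis
      unfolding I_def sum_dx2_mult_cnj[OF assms(3) bd(3)]
      by (simp only: uminus_complex.sel Re_sum sum_divide_distrib flip: minus_divide_left)
  qed
  \<comment> \<open>Only the node \<open>M\<close> contributes; it is interior because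
    \<open>M > 0\<close>.\<close>
  have delta: "(\<Sum>j\<in>I. lam * delta_coeff h M j * (D j / 2)) = lam * D M / (2 * h)"
  proof -
    have "(\<Sum>j\<in>I. lam * delta_coeff h M j * (D j / 2))
        = (\<Sum>j\<in>I. if j = M then lam * D M / (2 * h) else 0)"
      by (rule sum.cong) (auto simp: delta_coeff_def)
    then show ?thesis using assms(3) by (simp add: I_def)
  qed
  \<comment> \<open>Both time levels vanish at node 0, so the two \<open>Q_reg\<close> values there
    cancel.\<close>
  have pot: "(\<Sum>j\<in>I. P j) = (\<Sum>j<2 * M. P j)"
    unfolding I_def using assms(3) bd
    by (subst sum_lessThan_eq_interior) (auto simp: Zh0_def P_def)
  have "0 = (\<Sum>j\<in>I. - Re (dx2 h w j * cnj (d j)) + lam * delta_coeff h M j * (D j / 2) + \<mu> * (P j / 2))"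
    by (simp only: sum.neutral_const flip: eq cong: sum.cong)
  also have "\<dots> = - Re (\<Sum>j\<in>I. dx2 h w j * cnj (d j)) + lam * D M / (2 * h) + \<mu> * (\<Sum>j\<in>I. P j) / 2"
    unfolding sum.distrib delta
    by (simp only: Re_sum sum_negf sum_distrib_left sum_divide_distrib times_divide_eq_right)
  finally have "0 = (\<Sum>j<2 * M. (cmod (dx_plus h v j))\<^sup>2 - (cmod (dx_plus h u j))\<^sup>2) / 2
      + lam * D M / (2 * h) + \<mu> * (\<Sum>j<2 * M. P j) / 2"
    unfolding kin pot by simp
  \<comment> \<open>The factor \<open>2 * h\<close> cancels the weight \<open>1 / h\<close> of the
    discrete delta and supplies the mesh weight \<open>h\<close> in the other two sums.\<close>
  then have "2 * h * 0 = 2 * h * ((\<Sum>j<2 * M. (cmod (dx_plus h v j))\<^sup>2 - (cmod (dx_plus h u j))\<^sup>2) / 2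
      + lam * D M / (2 * h) + \<mu> * (\<Sum>j<2 * M. P j) / 2)"
    by (rule arg_cong)
  then have "0 = h * (\<Sum>j<2 * M. (cmod (dx_plus h v j))\<^sup>2 - (cmod (dx_plus h u j))\<^sup>2)
      + lam * D M + \<mu> * h * (\<Sum>j<2 * M. P j)"
    using assms(1) by (simp add: distrib_left mult_ac)
  then show ?thesis
    using assms(1)
    by (simp add: discrete_energy_def mesh_norm_power2 sum_subtractf D_def P_def algebra_simps
        flip: u_def v_def)
qed

theorem lemma2p2:
  fixes a h \<tau> \<epsilon> lam \<mu> :: real
    and M :: nat
    and u0 :: "real \<Rightarrow> complex"
    and U :: "nat \<Rightarrow> nat \<Rightarrow> complex"
  assumes "a > 0" and "\<epsilon> > 0" and "\<tau> > 0" and "M > 0"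
    and "h = a / real M"
    and "u0 (- a) = 0" and "u0 a = 0"
    and "CNFD_solution a M h \<tau> \<epsilon> lam \<mu> u0 U"
  shows "\<forall>k. discrete_energy M h \<epsilon> lam \<mu> (U k) = discrete_energy M h \<epsilon> lam \<mu> (U 0)
           \<and> discrete_mass M h (U k) = discrete_mass M h (U 0)"
proof
  fix k
  have h: "h > 0" using assms by simp
  show "discrete_energy M h \<epsilon> lam \<mu> (U k) = discrete_energy M h \<epsilon> lam \<mu> (U 0)
      \<and> discrete_mass M h (U k) = discrete_mass M h (U 0)"
    by (induction k)
      (simp_all add: CNFD_step_mass[OF h \<open>\<tau> > 0\<close> \<open>M > 0\<close> assms(8)]
        CNFD_step_energy[OF h \<open>\<epsilon> > 0\<close> \<open>M > 0\<close> assms(8)])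
qed

end
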